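(* There exist absolute constants $c_1,c_2\in\mathbb N$ with the following property. Let $d\in\mathbb N$, let $D_d\subset\mathbb R^d$ be compact, let $\varrho_d$ be a probability measure on $D_d$ with full support, and let $H(K_d)$ be a reproducing kernel Hilbert space of complex-valued functions on $D_d$ with a Hermitian positive definite continuous kernel $K_d$ satisfying $\sup_{\mathbf x\in D_d}K_d(\mathbf x,\mathbf x)<\infty$, such that all eigenvalues of $W_d=I_{2,d}^*I_{2,d}$ are positive. Then for every $m\in\mathbb N$, $$ g_{c_1m}(I_{\infty,d})^2\le c_2\max\Big\{\frac{N_{\varrho_d}(m)}{m}\sum_{k\ge \lfloor m/2\rfloor}\sigma_{k,d}^2,\ \sum_{k\ge\lfloor m/4\rfloor}\frac{N_{\varrho_d}(4k)\,\sigma_{k,d}^2}{k}\Big\},$$ where the sums range over integers $k\ge 1$ satisfying the indicated lower bound.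
   Context: $I_{q,d}:H(K_d)\to L_q(\varrho_d)$, $I_{q,d}f=f$, where $L_\infty(D_d)$ carries the norm $\|f\|_\infty=\sup_{\mathbf x\in D_d}|f(\mathbf x)|$. Let $(\lambda_{k,d},e_{k,d})_{k\in\mathbb N}$ be the eigenpairs of the compact operator $W_d=I_{2,d}^*I_{2,d}:H(K_d)\to H(K_d)$ with $\lambda_{1,d}\ge\lambda_{2,d}\ge\dots>0$ and $\{e_{k,d}\}$ an orthonormal basis of $H(K_d)$; set $\sigma_{k,d}=\sqrt{\lambda_{k,d}}$ and $\eta_{k,d}=\lambda_{k,d}^{-1/2}e_{k,d}$. For $m\in\mathbb N$, $N_{\varrho_d}(m)=\sup_{\mathbf x\in D_d}\sum_{k=1}^m|\eta_{k,d}(\mathbf x)|^2$. The sampling number $g_n(I_{\infty,d})$ is the infimum, over all algorithms of the form $A(f)=\phi(f(\mathbf x^1),\dots,f(\mathbf x^n))$ with points $\mathbf x^i\in D_d$ and arbitrary mappings $\phi:\mathbb C^n\to L_\infty(D_d)$, of $\sup_{\|f\|_{H(K_d)}\le1}\|f-A(f)\|_\infty$. *)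

theory Defs
  imports "HOL-Probability.Probability"
begin

text \<open>Points of R^d are modelled as functions nat => real vanishing at all
coordinates i >= d (so a single ambient type serves every dimension d; the
product topology on this subspace is the Euclidean topology of R^d).\<close>
type_synonym pt = "nat \<Rightarrow> real"

definition in_Rd :: "nat \<Rightarrow> pt set" where
  "in_Rd d = {x. \<forall>i\<ge>d. x i = 0}"

definition hnorm :: "((pt \<Rightarrow> complex) \<Rightarrow> (pt \<Rightarrow> complex) \<Rightarrow> complex) \<Rightarrow> (pt \<Rightarrow> complex) \<Rightarrow> real" where
  "hnorm ip f = sqrt (Re (ip f f))"

definition L2_ip :: "pt measure \<Rightarrow> (pt \<Rightarrow> complex) \<Rightarrow> (pt \<Rightarrow> complex) \<Rightarrow> complex" where
  "L2_ip M f g = integral\<^sup>L M (\<lambda>x. f x * cnj (g x))"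

definition ksec :: "pt set \<Rightarrow> (pt \<Rightarrow> pt \<Rightarrow> complex) \<Rightarrow> pt \<Rightarrow> (pt \<Rightarrow> complex)" where
  "ksec D K x = (\<lambda>y. if y \<in> D then K y x else 0)"

text \<open>(H, ip) is a (complex) reproducing kernel Hilbert space of functions on D
with reproducing kernel K.  Functions are identified with their restriction
to D (they vanish outside D).\<close>
definition is_rkhs ::
  "pt set \<Rightarrow> (pt \<Rightarrow> pt \<Rightarrow> complex) \<Rightarrow> (pt \<Rightarrow> complex) set
     \<Rightarrow> ((pt \<Rightarrow> complex) \<Rightarrow> (pt \<Rightarrow> complex) \<Rightarrow> complex) \<Rightarrow> bool" where
  "is_rkhs D K H ip \<longleftrightarrow>
     (\<forall>f\<in>H. \<forall>x. x \<notin> D \<longrightarrow> f x = 0) \<and>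
     (\<lambda>x. 0) \<in> H \<and>
     (\<forall>f\<in>H. \<forall>g\<in>H. (\<lambda>x. f x + g x) \<in> H) \<and>
     (\<forall>f\<in>H. \<forall>c. (\<lambda>x. c * f x) \<in> H) \<and>
     (\<forall>f\<in>H. \<forall>g\<in>H. \<forall>h\<in>H. ip (\<lambda>x. f x + g x) h = ip f h + ip g h) \<and>
     (\<forall>f\<in>H. \<forall>g\<in>H. \<forall>c. ip (\<lambda>x. c * f x) g = c * ip f g) \<and>
     (\<forall>f\<in>H. \<forall>g\<in>H. ip f g = cnj (ip g f)) \<and>
     (\<forall>f\<in>H. Re (ip f f) \<ge> 0) \<and>
     (\<forall>f\<in>H. ip f f = 0 \<longrightarrow> f = (\<lambda>x. 0)) \<and>
     (\<forall>s. (\<forall>n. s n \<in> H) \<and>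
          (\<forall>\<epsilon>>0. \<exists>N. \<forall>a\<ge>N. \<forall>b\<ge>N. hnorm ip (\<lambda>x. s a x - s b x) < \<epsilon>)
          \<longrightarrow> (\<exists>f\<in>H. (\<lambda>n. hnorm ip (\<lambda>x. s n x - f x)) \<longlonglongrightarrow> 0)) \<and>
     (\<forall>x\<in>D. ksec D K x \<in> H) \<and>
     (\<forall>f\<in>H. \<forall>x\<in>D. f x = ip f (ksec D K x))"

text \<open>The operator W = I_2^* I_2 : H(K) -> H(K): W f is the unique h in H with
<h,g>_H = <I_2 f, I_2 g>_{L_2} for all g in H.\<close>
definition W_op ::
  "pt measure \<Rightarrow> (pt \<Rightarrow> complex) set \<Rightarrow> ((pt \<Rightarrow> complex) \<Rightarrow> (pt \<Rightarrow> complex) \<Rightarrow> complex)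
     \<Rightarrow> (pt \<Rightarrow> complex) \<Rightarrow> (pt \<Rightarrow> complex)" where
  "W_op M H ip f = (THE h. h \<in> H \<and> (\<forall>g\<in>H. ip h g = L2_ip M f g))"

definition setting ::
  "nat \<Rightarrow> pt set \<Rightarrow> pt measure \<Rightarrow> (pt \<Rightarrow> pt \<Rightarrow> complex) \<Rightarrow> (pt \<Rightarrow> complex) set
     \<Rightarrow> ((pt \<Rightarrow> complex) \<Rightarrow> (pt \<Rightarrow> complex) \<Rightarrow> complex)
     \<Rightarrow> (nat \<Rightarrow> pt \<Rightarrow> complex) \<Rightarrow> (nat \<Rightarrow> real) \<Rightarrow> bool" where
  "setting d D M K H ip e lam \<longleftrightarrow>
     d \<ge> 1 \<and> D \<subseteq> in_Rd d \<and> compact D \<and>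
     prob_space M \<and> space M = D \<and> sets M = sets (restrict_space borel D) \<and>
     (\<forall>U. open U \<and> U \<inter> D \<noteq> {} \<longrightarrow> emeasure M (U \<inter> D) > 0) \<and>
     (\<forall>x\<in>D. \<forall>y\<in>D. K x y = cnj (K y x)) \<and>
     (\<forall>n (xs :: nat \<Rightarrow> pt) (a :: nat \<Rightarrow> complex). (\<forall>i<n. xs i \<in> D) \<longrightarrow>
        Re (\<Sum>i<n. \<Sum>j<n. cnj (a i) * a j * K (xs i) (xs j)) \<ge> 0 \<and>
        Im (\<Sum>i<n. \<Sum>j<n. cnj (a i) * a j * K (xs i) (xs j)) = 0) \<and>
     continuous_on (D \<times> D) (\<lambda>(x, y). K x y) \<and>
     (\<exists>B. \<forall>x\<in>D. cmod (K x x) \<le> B) \<and>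
     is_rkhs D K H ip \<and>
     (\<forall>k\<ge>1. e k \<in> H) \<and>
     (\<forall>j\<ge>1. \<forall>k\<ge>1. ip (e j) (e k) = (if j = k then 1 else 0)) \<and>
     (\<forall>f\<in>H. (\<forall>k\<ge>1. ip f (e k) = 0) \<longrightarrow> f = (\<lambda>x. 0)) \<and>
     (\<forall>k\<ge>1. lam k > 0 \<and> lam (Suc k) \<le> lam k) \<and>
     (\<forall>k\<ge>1. W_op M H ip (e k) = (\<lambda>x. complex_of_real (lam k) * e k x))"

definition sig :: "(nat \<Rightarrow> real) \<Rightarrow> nat \<Rightarrow> real" where
  "sig lam k = sqrt (lam k)"

definition Nrho :: "pt set \<Rightarrow> (nat \<Rightarrow> pt \<Rightarrow> complex) \<Rightarrow> (nat \<Rightarrow> real) \<Rightarrow> nat \<Rightarrow> ennreal" where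
  "Nrho D e lam m =
     (SUP x\<in>D. ennreal (\<Sum>k=1..m. (cmod (complex_of_real (1 / sqrt (lam k)) * e k x))\<^sup>2))"

definition sampling_number ::
  "pt set \<Rightarrow> (pt \<Rightarrow> complex) set \<Rightarrow> ((pt \<Rightarrow> complex) \<Rightarrow> (pt \<Rightarrow> complex) \<Rightarrow> complex)
     \<Rightarrow> nat \<Rightarrow> ennreal" where
  "sampling_number D H ip n =
     (INF (xs, \<phi>) \<in> {(xs :: pt list, \<phi> :: complex list \<Rightarrow> pt \<Rightarrow> complex).
                        length xs = n \<and> set xs \<subseteq> D \<and> (\<forall>v. bounded (\<phi> v ` D))}.
        SUP f \<in> {f \<in> H. hnorm ip f \<le> 1}.
          SUP x \<in> D. ennreal (cmod (f x - \<phi> (map f xs) x)))"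

end

theory Submission
  imports Defs
begin

text \<open>
  Let \<open>K\<^sub>x\<close> be the kernel section at \<open>x\<close>. A function of norm at most 1 vanishing on a node set \<open>X\<close>
  is bounded at \<open>x\<close> by the distance of \<open>K\<^sub>x\<close> to the span of the sections at the nodes. Take for \<open>X\<close>
  Fekete points, i.e. \<open>n\<close> points (almost) maximising the Gram determinant of the sections, and
  let \<open>P\<close> be the squared distance at a further point \<open>x\<close>. By maximality, removing any point from
  \<open>Y = X \<union> {x}\<close> leaves (up to a factor 2) at least the squared distance \<open>P\<close>, so that the Lagrange
  functions \<open>h\<^sub>y\<close> of \<open>Y\<close> satisfy \<open>\<parallel>h\<^sub>y\<parallel>\<^sup>2 \<le> 2 / P\<close>. Since \<open>\<Sum>y. \<langle>h\<^sub>y, K\<^sub>y\<rangle> = n + 1\<close>, of which the span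
  of \<open>e\<^sub>1, \<dots>, e\<^sub>r\<close> accounts for at most \<open>r\<close>, the Cauchy-Schwarz inequality bounds \<open>P\<close> by a
  multiple of \<open>sup\<^sub>x \<Sum>k>r. |e\<^sub>k(x)|\<^sup>2\<close> as soon as \<open>2r \<le> n + 1\<close>. Averaging over \<open>k/2 \<le> l \<le> k\<close>
  bounds this tail by the second term of the maximum, and \<open>c\<^sub>1 = 4\<close>, \<open>c\<^sub>2 = 64\<close> suffice.
\<close>

section \<open>Inner product calculus in a reproducing kernel Hilbert space\<close>

locale complex_rkhs =
  fixes D :: "pt set" and K :: "pt \<Rightarrow> pt \<Rightarrow> complex" and H :: "(pt \<Rightarrow> complex) set"
    and ip :: "(pt \<Rightarrow> complex) \<Rightarrow> (pt \<Rightarrow> complex) \<Rightarrow> complex"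
  assumes rkhs: "is_rkhs D K H ip"
begin

lemma zero_mem: "(\<lambda>x. 0) \<in> H"
  and add_mem: "f \<in> H \<Longrightarrow> g \<in> H \<Longrightarrow> (\<lambda>x. f x + g x) \<in> H"
  and scale_mem: "f \<in> H \<Longrightarrow> (\<lambda>x. c * f x) \<in> H"
  and ip_add_left: "f \<in> H \<Longrightarrow> g \<in> H \<Longrightarrow> h \<in> H \<Longrightarrow> ip (\<lambda>x. f x + g x) h = ip f h + ip g h"
  and ip_scale_left: "f \<in> H \<Longrightarrow> g \<in> H \<Longrightarrow> ip (\<lambda>x. c * f x) g = c * ip f g"
  and ip_nonneg: "f \<in> H \<Longrightarrow> Re (ip f f) \<ge> 0"
  and ip_definite: "f \<in> H \<Longrightarrow> ip f f = 0 \<Longrightarrow> f = (\<lambda>x. 0)"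
  and ksec_mem: "x \<in> D \<Longrightarrow> ksec D K x \<in> H"
  using rkhs unfolding is_rkhs_def by blast+

lemma reproducing: "f \<in> H \<Longrightarrow> x \<in> D \<Longrightarrow> ip f (ksec D K x) = f x"
  by (rule sym) (use rkhs in \<open>unfold is_rkhs_def, blast\<close>)

lemma ip_commute: "f \<in> H \<Longrightarrow> g \<in> H \<Longrightarrow> ip f g = cnj (ip g f)"
  using rkhs unfolding is_rkhs_def by blast

lemma complete:
  assumes "\<And>n. s n \<in> H"
    and "\<And>\<epsilon>. \<epsilon> > 0 \<Longrightarrow> \<exists>N. \<forall>a\<ge>N. \<forall>b\<ge>N. hnorm ip (\<lambda>x. s a x - s b x) < \<epsilon>"
  obtains f where "f \<in> H" "(\<lambda>n. hnorm ip (\<lambda>x. s n x - f x)) \<longlonglongrightarrow> 0"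
proof -
  have "\<forall>s. (\<forall>n. s n \<in> H) \<and>
          (\<forall>\<epsilon>>0. \<exists>N. \<forall>a\<ge>N. \<forall>b\<ge>N. hnorm ip (\<lambda>x. s a x - s b x) < \<epsilon>)
          \<longrightarrow> (\<exists>f\<in>H. (\<lambda>n. hnorm ip (\<lambda>x. s n x - f x)) \<longlonglongrightarrow> 0)"
    using rkhs unfolding is_rkhs_def by (elim conjE)
  with assms that show thesis by blast
qed

lemma diff_mem: "f \<in> H \<Longrightarrow> g \<in> H \<Longrightarrow> (\<lambda>x. f x - g x) \<in> H"
  using add_mem[of f "\<lambda>x. (-1) * g x"] scale_mem[of g "-1"] by simp

lemma ip_diff_left: "f \<in> H \<Longrightarrow> g \<in> H \<Longrightarrow> h \<in> H \<Longrightarrow> ip (\<lambda>x. f x - g x) h = ip f h - ip g h"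
  using ip_add_left[of f "\<lambda>x. (-1) * g x" h] scale_mem[of g "-1"] ip_scale_left[of g h "-1"]
  by simp

lemma ip_diff_right: "f \<in> H \<Longrightarrow> g \<in> H \<Longrightarrow> h \<in> H \<Longrightarrow> ip h (\<lambda>x. f x - g x) = ip h f - ip h g"
  by (simp add: ip_commute[of h] diff_mem ip_diff_left)

lemma ip_scale_right: "f \<in> H \<Longrightarrow> g \<in> H \<Longrightarrow> ip g (\<lambda>x. c * f x) = cnj c * ip g f"
  by (simp add: ip_commute[of g] scale_mem ip_scale_left)

lemma ip_zero_left: "f \<in> H \<Longrightarrow> ip (\<lambda>x. 0) f = 0"
  using ip_scale_left[of f f 0] by simp

lemma ip_zero_right: "f \<in> H \<Longrightarrow> ip f (\<lambda>x. 0) = 0"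
  using ip_scale_right[of f f 0] by simp

lemma lincomb_mem:
  assumes "\<And>i. i \<in> A \<Longrightarrow> f i \<in> H"
  shows "(\<lambda>x. \<Sum>i\<in>A. c i * f i x) \<in> H"
  using assms by (induction A rule: infinite_finite_induct) (auto intro!: zero_mem add_mem scale_mem)

lemma ip_lincomb_left:
  assumes "\<And>i. i \<in> A \<Longrightarrow> f i \<in> H" "g \<in> H"
  shows "ip (\<lambda>x. \<Sum>i\<in>A. c i * f i x) g = (\<Sum>i\<in>A. c i * ip (f i) g)"
  using assms
  by (induction A rule: infinite_finite_induct)
     (auto simp: ip_zero_left ip_add_left ip_scale_left scale_mem lincomb_mem)

lemma ip_lincomb_right:
  assumes "\<And>i. i \<in> A \<Longrightarrow> f i \<in> H" "g \<in> H"
  shows "ip g (\<lambda>x. \<Sum>i\<in>A. c i * f i x) = (\<Sum>i\<in>A. cnj (c i) * ip g (f i))"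
proof -
  have "ip g (\<lambda>x. \<Sum>i\<in>A. c i * f i x) = cnj (\<Sum>i\<in>A. c i * ip (f i) g)"
    using assms by (simp add: ip_commute[of g] lincomb_mem ip_lincomb_left)
  also have "\<dots> = (\<Sum>i\<in>A. cnj (c i) * ip g (f i))"
    using assms by (auto simp: ip_commute[of g] intro!: sum.cong)
  finally show ?thesis .
qed

lemma ip_self_real: "f \<in> H \<Longrightarrow> ip f f = of_real (Re (ip f f))"
  using ip_commute[of f f] by (simp add: complex_eq_iff)

lemma ip_self_eq_0: "f \<in> H \<Longrightarrow> Re (ip f f) = 0 \<Longrightarrow> f = (\<lambda>x. 0)"
  using ip_self_real[of f] ip_definite[of f] by simp

lemma Cauchy_Schwarz:
  assumes f: "f \<in> H" and g: "g \<in> H"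
  shows "(cmod (ip f g))\<^sup>2 \<le> Re (ip f f) * Re (ip g g)"
proof (cases "Re (ip g g) = 0")
  case True
  then have "g = (\<lambda>x. 0)" using g ip_self_eq_0 by blast
  then show ?thesis using f by (simp add: ip_zero_right ip_zero_left zero_mem)
next
  case False
  define G where "G = Re (ip g g)"
  have G: "G > 0" "ip g g = of_real G" using False ip_nonneg[OF g] ip_self_real[OF g] by (auto simp: G_def)
  define c where "c = ip f g / of_real G"
  have m: "(\<lambda>x. c * g x) \<in> H" "(\<lambda>x. f x - c * g x) \<in> H"
    using f g scale_mem diff_mem by auto
  have "ip (\<lambda>x. f x - c * g x) (\<lambda>x. f x - c * g x)
      = ip f f - cnj c * ip f g - c * cnj (ip f g) + c * cnj c * of_real G"
    using m f g G(2) by (simp add: ip_diff_left ip_diff_right ip_scale_left ip_scale_right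
      ip_commute[of g f] algebra_simps)
  also have "\<dots> = ip f f - ip f g * cnj (ip f g) / of_real G"
    using G(1) by (simp add: c_def field_simps)
  also have "\<dots> = ip f f - of_real ((cmod (ip f g))\<^sup>2 / G)"
    by (simp only: complex_norm_square of_real_divide)
  finally have "0 \<le> Re (ip f f - of_real ((cmod (ip f g))\<^sup>2 / G))"
    using ip_nonneg[OF m(2)] by simp
  then show ?thesis using G(1) by (simp add: field_simps G_def)
qed

section \<open>Residuals of kernel sections relative to a node set\<close>

text \<open>\<open>res X x\<close> is the component of the kernel section at \<open>x\<close> orthogonal to the sections at the
  points of \<open>X\<close>. If \<open>res X a a = 0\<close> then \<open>res X a = 0\<close>, so that the junk value of the
  division is harmless.\<close>

fun res :: "pt list \<Rightarrow> pt \<Rightarrow> pt \<Rightarrow> complex" where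
  "res [] x = ksec D K x"
| "res (a # X) x = (\<lambda>y. res X x y - res X x a / res X a a * res X a y)"

text \<open>One Gram-Schmidt step per node. The three properties characterise \<open>res X x\<close>
  as the reproducing kernel section at \<open>x\<close> of the subspace of functions vanishing on
  \<open>X\<close>; all later facts about residuals rest on them.\<close>

lemma res_char:
  assumes "set X \<subseteq> D" "x \<in> D"
  shows "res X x \<in> H \<and> (\<forall>z\<in>set X. res X x z = 0) \<and>
    (\<forall>f\<in>H. (\<forall>z\<in>set X. f z = 0) \<longrightarrow> ip f (res X x) = f x)"
  using assms
proof (induction X arbitrary: x)
  case Nil
  then show ?case by (simp add: ksec_mem reproducing)
next
  case (Cons a X)
  have a: "a \<in> D" and X: "set X \<subseteq> D" using Cons.prems by auto
  note Ix = Cons.IH[OF X \<open>x \<in> D\<close>] and Ia = Cons.IH[OF X a]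
  \<comment> \<open>In the degenerate case the numerator vanishes as well, because
    \<open>res X x a\<close> is the inner product of \<open>res X x\<close> with
    \<open>res X a = 0\<close>.\<close>
  have van: "res X x a = 0" if "res X a a = 0"
  proof -
    have "ip (res X a) (res X a) = 0" using Ia that by auto
    then have "res X a = (\<lambda>x. 0)" using ip_definite Ia by blast
    moreover have "ip (res X x) (res X a) = res X x a" using Ia Ix by blast
    ultimately show ?thesis using ip_zero_right Ix by metis
  qed
  have m: "(\<lambda>y. res X x a / res X a a * res X a y) \<in> H" using Ia scale_mem by blast
  have "res (a # X) x \<in> H" using Ix m diff_mem by simp
  moreover have "\<forall>z\<in>set (a # X). res (a # X) x z = 0"
    using Ix Ia van by (cases "res X a a = 0") auto
  moreover have "ip f (res (a # X) x) = f x" if "f \<in> H" "\<forall>z\<in>set (a # X). f z = 0" for f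
  proof -
    have "ip f (res X a) = 0" "ip f (res X x) = f x" using Ia Ix that by auto
    then show ?thesis
      using ip_diff_right[OF _ m that(1), of "res X x"] Ia Ix
        ip_scale_right[OF _ that(1), of "res X a" "res X x a / res X a a"] by simp
  qed
  ultimately show ?case by blast
qed

lemma res_mem: "set X \<subseteq> D \<Longrightarrow> x \<in> D \<Longrightarrow> res X x \<in> H"
  and res_vanish: "set X \<subseteq> D \<Longrightarrow> x \<in> D \<Longrightarrow> z \<in> set X \<Longrightarrow> res X x z = 0"
  and ip_res: "set X \<subseteq> D \<Longrightarrow> x \<in> D \<Longrightarrow> f \<in> H \<Longrightarrow> (\<And>z. z \<in> set X \<Longrightarrow> f z = 0) \<Longrightarrow> ip f (res X x) = f x"
  using res_char by blast+

text \<open>The recursion depends on the order of the nodes, its characterisation does not: the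
  difference of the two residuals vanishes on the nodes and is therefore orthogonal to
  itself.\<close>

lemma res_cong:
  assumes "set X = set Y" "set X \<subseteq> D" "x \<in> D"
  shows "res X x = res Y x"
proof -
  let ?g = "\<lambda>z. res X x z - res Y x z"
  have m: "res X x \<in> H" "res Y x \<in> H" "?g \<in> H" using assms res_mem diff_mem by auto
  have z: "\<And>z. z \<in> set X \<Longrightarrow> ?g z = 0" using assms res_vanish by simp
  have "ip ?g ?g = ip ?g (res X x) - ip ?g (res Y x)" using m ip_diff_right by blast
  also have "\<dots> = 0" using ip_res[of X x ?g] ip_res[of Y x ?g] assms m z by simp
  finally have "?g = (\<lambda>x. 0)" using m ip_definite by blast
  then show ?thesis by (simp add: fun_eq_iff)
qed

lemma res_self: "set X \<subseteq> D \<Longrightarrow> x \<in> D \<Longrightarrow> ip (res X x) (res X x) = res X x x"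
  by (simp add: ip_res res_mem res_vanish)

lemma res_diag_nonneg: "set X \<subseteq> D \<Longrightarrow> x \<in> D \<Longrightarrow> Re (res X x x) \<ge> 0"
  using ip_nonneg[OF res_mem] res_self by metis

lemma res_diag_real: "set X \<subseteq> D \<Longrightarrow> x \<in> D \<Longrightarrow> res X x x = of_real (Re (res X x x))"
  using ip_self_real[OF res_mem] res_self by metis

text \<open>Cauchy-Schwarz applied to \<open>f x = ip f (res X x)\<close>. This turns the diagonal
  of \<open>res\<close> into a bound for the worst-case error.\<close>

lemma vanish_bound:
  assumes "set X \<subseteq> D" "x \<in> D" "f \<in> H" "\<And>z. z \<in> set X \<Longrightarrow> f z = 0"
  shows "(cmod (f x))\<^sup>2 \<le> Re (ip f f) * Re (res X x x)"
  using Cauchy_Schwarz[OF assms(3) res_mem[OF assms(1,2)]] assms by (simp add: ip_res res_self)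

text \<open>\<open>res Y x\<close> itself vanishes on \<open>X\<close>, so
  \<open>vanish_bound\<close> applies to it; one factor then cancels.\<close>

lemma res_diag_mono:
  assumes "set X \<subseteq> set Y" "set Y \<subseteq> D" "x \<in> D"
  shows "Re (res Y x x) \<le> Re (res X x x)"
proof -
  have X: "set X \<subseteq> D" using assms by auto
  have "(cmod (res Y x x))\<^sup>2 \<le> Re (res Y x x) * Re (res X x x)"
    using vanish_bound[OF X assms(3) res_mem[OF assms(2,3)]] res_vanish[OF assms(2,3)]
      res_self[OF assms(2,3)] assms(1) by auto
  then have "Re (res Y x x) * Re (res Y x x) \<le> Re (res Y x x) * Re (res X x x)"
    using res_diag_real[OF assms(2,3)] by (metis norm_of_real power2_abs power2_eq_square)
  then show ?thesis using res_diag_nonneg[OF assms(2,3)] res_diag_nonneg[OF X assms(3)]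
    by (cases "Re (res Y x x) = 0") auto
qed

section \<open>Gram determinants and their independence of the node order\<close>

text \<open>The Gram determinant of the kernel sections, expanded into Schur complements.\<close>

fun vol :: "pt list \<Rightarrow> real" where
  "vol [] = 1"
| "vol (a # X) = Re (res X a a) * vol X"

lemma vol_nonneg: "set X \<subseteq> D \<Longrightarrow> vol X \<ge> 0"
  by (induction X) (auto simp: res_diag_nonneg)

text \<open>Hadamard's inequality: each Schur complement is at most the diagonal entry of
  \<open>K\<close>. It makes the supremum over all node sets finite.\<close>

lemma vol_bound:
  assumes "\<And>x. x \<in> D \<Longrightarrow> Re (K x x) \<le> B" "B \<ge> 0" "set X \<subseteq> D"
  shows "vol X \<le> B ^ length X"
  using assms(3)
proof (induction X)
  case (Cons a X)
  then have "Re (res X a a) \<le> B"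
    using res_diag_mono[of "[]" X a] assms(1)[of a] by (auto simp: ksec_def)
  then show ?case using Cons vol_nonneg[of X] assms(2) by (auto intro!: mult_mono)
qed simp

lemma vol_distinct: "set X \<subseteq> D \<Longrightarrow> vol X \<noteq> 0 \<Longrightarrow> distinct X"
  by (induction X) (auto simp: res_vanish)

text \<open>Up to the common factor \<open>vol X\<close>, both sides are the 2x2 determinant of
  \<open>res X\<close> on \<open>a\<close> and \<open>b\<close>, which is symmetric in them.\<close>

lemma vol_swap:
  assumes "set X \<subseteq> D" "a \<in> D" "b \<in> D"
  shows "vol (a # b # X) = vol (b # a # X)"
proof -
  have *: "res (b # X) a a * res X b b = res X a a * res X b b - res X a b * res X b a"
    if "a \<in> D" "b \<in> D" for a b
  proof (cases "res X b b = 0")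
    \<comment> \<open>Here the quotient has the default value 0, and the identity survives because a
      zero diagonal entry forces \<open>res X a b = 0\<close>.\<close>
    case True
    then have "(cmod (res X a b))\<^sup>2 \<le> 0"
      using vanish_bound[of X b "res X a"] assms(1) that by (simp add: res_mem res_vanish)
    then show ?thesis using True by simp
  qed (simp add: field_simps)
  have r: "Re (res (b # X) a a) * Re (res X b b) = Re (res (b # X) a a * res X b b)"
    if "a \<in> D" "b \<in> D" for a b
    using arg_cong[OF res_diag_real[of X b], of Im] that assms(1) by (simp del: res.simps)
  have "Re (res (b # X) a a) * Re (res X b b) = Re (res (a # X) b b) * Re (res X a a)"
    using *[of a b] *[of b a] r[of a b] r[of b a] assms
    by (simp add: mult.commute del: res.simps)
  then show ?thesis by (simp del: res.simps)
qed

text \<open>Since a residual depends only on the set of nodes, \<open>y\<close> can be moved to the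
  front of the tail and then exchanged with the head.\<close>

lemma vol_remove1:
  assumes "set Y \<subseteq> D" "y \<in> set Y"
  shows "vol Y = Re (res (remove1 y Y) y y) * vol (remove1 y Y)"
  using assms
proof (induction Y)
  case (Cons a Y)
  show ?case
  proof (cases "y = a")
    case False
    then have y: "y \<in> set Y" and Y: "set Y \<subseteq> D" "a \<in> D" "y \<in> D" using Cons.prems by auto
    have R: "set (remove1 y Y) \<subseteq> D" using Y set_remove1_subset by fast
    have "set (y # remove1 y Y) = set Y" using y by (induction Y) auto
    then have "res Y a = res (y # remove1 y Y) a" using Y by (intro res_cong) auto
    then have "vol (a # Y) = vol (a # y # remove1 y Y)"
      using Cons.IH[OF Y(1) y] by (simp del: res.simps)
    also have "\<dots> = vol (y # a # remove1 y Y)" using vol_swap R Y by blast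
    finally show ?thesis using False by simp
  qed simp
qed simp

section \<open>From residuals to sampling numbers\<close>

lemma diff_ip_self_le:
  assumes "f \<in> H" "g \<in> H" "Re (ip f f) \<le> 1" "Re (ip g g) \<le> 1"
  shows "Re (ip (\<lambda>x. f x - g x) (\<lambda>x. f x - g x)) \<le> 4"
proof -
  have "(cmod (ip f g))\<^sup>2 \<le> 1"
    using Cauchy_Schwarz[OF assms(1,2)] mult_mono[OF assms(3,4)] ip_nonneg assms by simp
  then have "- Re (ip f g) \<le> 1"
    using abs_Re_le_cmod[of "ip f g"] by (simp add: power_le_one_iff)
  moreover have "ip (\<lambda>x. f x - g x) (\<lambda>x. f x - g x) = ip f f - ip f g - cnj (ip f g) + ip g g"
    using assms by (simp add: ip_diff_left ip_diff_right diff_mem ip_commute[of g f])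
  ultimately show ?thesis using assms by simp
qed

text \<open>Any element of the unit ball interpolating the data is at most twice as bad as the
  best reconstruction, so that no explicit interpolation formula is needed.\<close>

lemma sampling_number_le:
  assumes B: "\<And>x. x \<in> D \<Longrightarrow> Re (K x x) \<le> B"
    and X: "set X \<subseteq> D" and c: "\<And>x. x \<in> D \<Longrightarrow> Re (res X x x) \<le> c"
  shows "sampling_number D H ip (length X) \<le> ennreal (2 * sqrt c)"
proof -
  define good where "good v f \<longleftrightarrow> f \<in> H \<and> Re (ip f f) \<le> 1 \<and> map f X = v" for v f
  \<comment> \<open>Data that no element of the unit ball produces are sent to 0, so that
    \<open>\<phi> v\<close> is bounded for every \<open>v\<close>, as admissibility demands.\<close>
  define \<phi> where "\<phi> v = (if \<exists>f. good v f then SOME f. good v f else (\<lambda>x. 0))" for v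
  have good_\<phi>: "good v (\<phi> v)" if "good v f" for v f
    using that someI[of "good v" f] by (auto simp: \<phi>_def)
  have "bounded (\<phi> v ` D)" for v
  proof (cases "\<exists>f. good v f")
    case True
    then have g: "\<phi> v \<in> H" "Re (ip (\<phi> v) (\<phi> v)) \<le> 1" using good_\<phi> by (auto simp: good_def)
    \<comment> \<open>\<open>vanish_bound\<close> without nodes is the pointwise bound by the kernel
      diagonal.\<close>
    have "cmod (\<phi> v x) \<le> sqrt \<bar>B\<bar>" if "x \<in> D" for x
    proof (rule real_le_rsqrt)
      have "Re (ip (\<phi> v) (\<phi> v)) * Re (K x x) \<le> 1 * \<bar>B\<bar>"
        using g ip_nonneg[OF g(1)] B[OF that] res_diag_nonneg[of "[]" x] that
        by (intro mult_mono) (auto simp: ksec_def)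
      then show "(cmod (\<phi> v x))\<^sup>2 \<le> \<bar>B\<bar>"
        using vanish_bound[of "[]" x "\<phi> v"] g that by (simp add: ksec_def)
    qed
    then show ?thesis by (auto simp: bounded_iff)
  qed (auto simp: \<phi>_def bounded_iff)
  then have adm: "(X, \<phi>) \<in> {(xs, \<phi>). length xs = length X \<and> set xs \<subseteq> D \<and> (\<forall>v. bounded (\<phi> v ` D))}"
    using X by simp
  have err: "cmod (f x - \<phi> (map f X) x) \<le> 2 * sqrt c" if f: "f \<in> H" "hnorm ip f \<le> 1" and x: "x \<in> D" for f x
  proof -
    have "good (map f X) f" using f ip_nonneg by (auto simp: good_def hnorm_def)
    from good_\<phi>[OF this] have g: "\<phi> (map f X) \<in> H" "Re (ip (\<phi> (map f X)) (\<phi> (map f X))) \<le> 1"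
      "\<And>z. z \<in> set X \<Longrightarrow> \<phi> (map f X) z = f z" by (auto simp: good_def)
    let ?h = "\<lambda>x. f x - \<phi> (map f X) x"
    have h: "?h \<in> H" using f g diff_mem by blast
    \<comment> \<open>Both functions lie in the unit ball, so their difference has norm at most 2;
      this is the factor 2 in the error. It vanishes on \<open>X\<close> because both match the
      data.\<close>
    have "Re (ip ?h ?h) \<le> 4" using diff_ip_self_le f g by (auto simp: hnorm_def)
    then have "Re (ip ?h ?h) * Re (res X x x) \<le> 4 * c"
      using c[OF x] ip_nonneg[OF h] res_diag_nonneg[OF X x] by (intro mult_mono) auto
    then have "(cmod (?h x))\<^sup>2 \<le> 4 * c" using vanish_bound[OF X x h] g(3) by simp
    then have "cmod (?h x) \<le> sqrt (4 * c)" by (rule real_le_rsqrt)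
    then show ?thesis by (simp add: real_sqrt_mult)
  qed
  show ?thesis unfolding sampling_number_def
    by (rule INF_lower2[OF adm]) (use err in \<open>auto intro!: SUP_least ennreal_leI\<close>)
qed

end

section \<open>Orthonormal expansions, projections and tails\<close>

locale rkhs_onb = complex_rkhs +
  fixes e :: "nat \<Rightarrow> pt \<Rightarrow> complex"
  assumes e_mem: "k \<ge> 1 \<Longrightarrow> e k \<in> H"
    and e_orthonormal: "j \<ge> 1 \<Longrightarrow> k \<ge> 1 \<Longrightarrow> ip (e j) (e k) = (if j = k then 1 else 0)"
    and e_total: "f \<in> H \<Longrightarrow> (\<And>k. k \<ge> 1 \<Longrightarrow> ip f (e k) = 0) \<Longrightarrow> f = (\<lambda>x. 0)"
begin

definition proj :: "nat \<Rightarrow> (pt \<Rightarrow> complex) \<Rightarrow> pt \<Rightarrow> complex" where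
  "proj r f = (\<lambda>x. \<Sum>k=1..r. ip f (e k) * e k x)"

definition tail :: "nat \<Rightarrow> (pt \<Rightarrow> complex) \<Rightarrow> pt \<Rightarrow> complex" where
  "tail r f = (\<lambda>x. f x - proj r f x)"

lemma proj_mem: "proj r f \<in> H"
  unfolding proj_def by (rule lincomb_mem) (simp add: e_mem)

lemma tail_mem: "f \<in> H \<Longrightarrow> tail r f \<in> H"
  unfolding tail_def using diff_mem proj_mem by blast

lemma ip_lincomb_e:
  assumes "finite A" "A \<subseteq> {1..}" "j \<ge> 1"
  shows "ip (\<lambda>x. \<Sum>k\<in>A. c k * e k x) (e j) = (if j \<in> A then c j else 0)"
proof -
  have "ip (\<lambda>x. \<Sum>k\<in>A. c k * e k x) (e j) = (\<Sum>k\<in>A. c k * ip (e k) (e j))"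
    using assms e_mem by (intro ip_lincomb_left) auto
  also have "\<dots> = (\<Sum>k\<in>A. if k = j then c k else 0)"
    using assms by (intro sum.cong) (auto simp: e_orthonormal)
  finally show ?thesis using assms by (simp add: sum.delta)
qed

lemma lincomb_e_norm:
  assumes "finite A" "A \<subseteq> {1..}"
  shows "Re (ip (\<lambda>x. \<Sum>k\<in>A. c k * e k x) (\<lambda>x. \<Sum>k\<in>A. c k * e k x)) = (\<Sum>k\<in>A. (cmod (c k))\<^sup>2)"
proof -
  let ?f = "\<lambda>x. \<Sum>k\<in>A. c k * e k x"
  have "?f \<in> H" using assms e_mem by (intro lincomb_mem) auto
  then have "ip ?f ?f = (\<Sum>k\<in>A. cnj (c k) * ip ?f (e k))"
    using assms e_mem by (intro ip_lincomb_right) auto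
  also have "\<dots> = (\<Sum>k\<in>A. of_real ((cmod (c k))\<^sup>2))"
  proof (rule sum.cong[OF refl])
    fix k assume k: "k \<in> A"
    then have "ip ?f (e k) = c k" using ip_lincomb_e[OF assms, of k c] assms by auto
    then show "cnj (c k) * ip ?f (e k) = of_real ((cmod (c k))\<^sup>2)"
      by (simp only: complex_norm_square mult.commute)
  qed
  finally show ?thesis by simp
qed

lemma ip_proj_e: "j \<ge> 1 \<Longrightarrow> ip (proj r f) (e j) = (if j \<le> r then ip f (e j) else 0)"
  unfolding proj_def by (subst ip_lincomb_e) auto

lemma ip_tail_e: "f \<in> H \<Longrightarrow> 1 \<le> j \<Longrightarrow> j \<le> r \<Longrightarrow> ip (tail r f) (e j) = 0"
  by (simp add: tail_def ip_diff_left proj_mem e_mem ip_proj_e)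

lemma tail_norm:
  assumes "f \<in> H"
  shows "Re (ip (tail r f) (tail r f)) = Re (ip f f) - (\<Sum>k=1..r. (cmod (ip f (e k)))\<^sup>2)"
proof -
  have "ip (tail r f) (proj r f) = (\<Sum>k=1..r. cnj (ip f (e k)) * ip (tail r f) (e k))"
    unfolding proj_def by (intro ip_lincomb_right) (auto simp: e_mem tail_mem assms)
  also have "\<dots> = 0" by (rule sum.neutral) (use assms ip_tail_e in auto)
  finally have 0: "ip (tail r f) (proj r f) = 0" .
  have "ip (tail r f) (tail r f) = ip (tail r f) f - ip (tail r f) (proj r f)"
    using ip_diff_right[OF assms proj_mem tail_mem[OF assms]] by (simp only: tail_def)
  then have 1: "ip (tail r f) (tail r f) = ip f f - ip (proj r f) f"
    using 0 ip_diff_left[OF assms proj_mem assms] by (simp add: tail_def)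
  have "ip f (proj r f) = ip (proj r f) (proj r f)"
    using 0 ip_diff_left[OF assms proj_mem proj_mem] by (simp add: tail_def)
  then have "Re (ip (proj r f) f) = Re (ip (proj r f) (proj r f))"
    using ip_commute[OF proj_mem assms, of r f] by simp
  also have "\<dots> = (\<Sum>k=1..r. (cmod (ip f (e k)))\<^sup>2)"
    unfolding proj_def by (rule lincomb_e_norm) auto
  finally show ?thesis using 1 by simp
qed

lemma proj_diff_norm:
  assumes "a \<le> b"
  shows "Re (ip (\<lambda>x. proj b f x - proj a f x) (\<lambda>x. proj b f x - proj a f x))
    = (\<Sum>k=1..b. (cmod (ip f (e k)))\<^sup>2) - (\<Sum>k=1..a. (cmod (ip f (e k)))\<^sup>2)"
proof -
  have split: "(\<Sum>k=1..b. g k) - (\<Sum>k=1..a. g k) = (\<Sum>k\<in>{a<..b}. g k)" for g :: "nat \<Rightarrow> 'z::ab_group_add"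
  proof -
    have "{1..b} = {1..a} \<union> {a<..b}" using assms by auto
    moreover have "sum g ({1..a} \<union> {a<..b}) = sum g {1..a} + sum g {a<..b}"
      by (rule sum.union_disjoint) auto
    ultimately show ?thesis by simp
  qed
  show ?thesis unfolding proj_def split by (rule lincomb_e_norm) auto
qed

text \<open>The partial sums increase and are bounded by the squared norm, so the projections form a
  Cauchy sequence. Completeness gives a limit \<open>g\<close>, and totality of the basis identifies
  \<open>g\<close> with \<open>f\<close>.\<close>

lemma Parseval:
  assumes f: "f \<in> H"
  shows "(\<lambda>n. \<Sum>k=1..n. (cmod (ip f (e k)))\<^sup>2) \<longlonglongrightarrow> Re (ip f f)"
proof -
  define S where "S n = (\<Sum>k=1..n. (cmod (ip f (e k)))\<^sup>2)" for n
  have tn: "Re (ip (tail n f) (tail n f)) = Re (ip f f) - S n" for n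
    using tail_norm[OF f] by (simp add: S_def)
  have "incseq S" unfolding S_def by (intro incseq_SucI) simp
  moreover have "S n \<le> Re (ip f f)" for n using tn[of n] ip_nonneg[OF tail_mem[OF f], of n] by simp
  ultimately obtain L where "S \<longlonglongrightarrow> L" using incseq_convergent by blast
  then have "Cauchy S" by (rule LIMSEQ_imp_Cauchy)
  have hn: "hnorm ip (\<lambda>x. proj a f x - proj b f x) = sqrt \<bar>S a - S b\<bar>" for a b
  proof (cases "b \<le> a")
    case True
    then show ?thesis using incseqD[OF \<open>incseq S\<close>, of b a]
      by (simp add: hnorm_def proj_diff_norm S_def)
  next
    case False
    let ?g = "\<lambda>x. proj b f x - proj a f x"
    have "?g \<in> H" using diff_mem proj_mem by blast
    then have "ip (\<lambda>x. (-1) * ?g x) (\<lambda>x. (-1) * ?g x) = ip ?g ?g"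
      using ip_scale_left[of ?g "\<lambda>x. (-1) * ?g x" "-1"] ip_scale_right[of ?g ?g "-1"] scale_mem[of ?g "-1"]
      by simp
    then have "hnorm ip (\<lambda>x. proj a f x - proj b f x) = hnorm ip ?g" by (simp add: hnorm_def)
    then show ?thesis using False incseqD[OF \<open>incseq S\<close>, of a b]
      by (simp add: hnorm_def proj_diff_norm S_def)
  qed
  obtain g where g: "g \<in> H" "(\<lambda>n. hnorm ip (\<lambda>x. proj n f x - g x)) \<longlonglongrightarrow> 0"
  proof (rule complete[of "\<lambda>n. proj n f"])
    show "\<exists>N. \<forall>a\<ge>N. \<forall>b\<ge>N. hnorm ip (\<lambda>x. proj a f x - proj b f x) < \<epsilon>" if "\<epsilon> > 0" for \<epsilon>
    proof -
      have "\<epsilon>\<^sup>2 > 0" using that by simp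
      then obtain N where "\<forall>a\<ge>N. \<forall>b\<ge>N. \<bar>S a - S b\<bar> < \<epsilon>\<^sup>2"
        using \<open>Cauchy S\<close> unfolding Cauchy_def dist_real_def by blast
      then show ?thesis using that hn by (auto simp: real_less_lsqrt intro!: exI[of _ N])
    qed
  qed (use proj_mem in auto)
  have "ip (\<lambda>x. f x - g x) (e k) = 0" if k: "k \<ge> 1" for k
  proof -
    \<comment> \<open>From index \<open>k\<close> on, the projection has the same coefficient at
      \<open>e k\<close> as \<open>f\<close>; the coefficient of \<open>f - g\<close> is thus
      bounded by a null sequence.\<close>
    have "cmod (ip (\<lambda>x. f x - g x) (e k)) \<le> hnorm ip (\<lambda>x. proj n f x - g x)" if n: "n \<ge> k" for n
    proof -
      have "ip (\<lambda>x. f x - g x) (e k) = ip (\<lambda>x. proj n f x - g x) (e k)"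
        using f g(1) k n by (simp add: ip_diff_left e_mem proj_mem ip_proj_e)
      moreover have "(cmod (ip (\<lambda>x. proj n f x - g x) (e k)))\<^sup>2 \<le> Re (ip (\<lambda>x. proj n f x - g x) (\<lambda>x. proj n f x - g x))"
        using Cauchy_Schwarz[OF diff_mem[OF proj_mem g(1)] e_mem[OF k]] e_orthonormal[OF k k] by simp
      ultimately show ?thesis unfolding hnorm_def by (simp add: real_le_rsqrt)
    qed
    then have "cmod (ip (\<lambda>x. f x - g x) (e k)) \<le> 0"
      by (intro LIMSEQ_le_const[OF g(2)]) blast
    then show ?thesis by simp
  qed
  then have "(\<lambda>x. f x - g x) = (\<lambda>x. 0)" using e_total diff_mem f g(1) by blast
  then have fg: "g = f" by (simp add: fun_eq_iff)
  have "(\<lambda>n. (hnorm ip (\<lambda>x. proj n f x - g x))\<^sup>2) \<longlonglongrightarrow> 0\<^sup>2" using g(2) by (rule tendsto_power)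
  moreover have "(hnorm ip (\<lambda>x. proj n f x - g x))\<^sup>2 = Re (ip f f) - S n" for n
  proof -
    have t: "tail n f \<in> H" using tail_mem f by blast
    have "(\<lambda>x. proj n f x - g x) = (\<lambda>x. (-1) * tail n f x)" by (simp add: tail_def fg)
    moreover have "ip (\<lambda>x. (-1) * tail n f x) (\<lambda>x. (-1) * tail n f x) = ip (tail n f) (tail n f)"
      using ip_scale_left[OF t scale_mem[OF t], of "-1" "-1"] ip_scale_right[OF t t, of "-1"] by simp
    ultimately show ?thesis using tn ip_nonneg[OF t] by (simp add: hnorm_def)
  qed
  ultimately have "(\<lambda>n. Re (ip f f) - (Re (ip f f) - S n)) \<longlonglongrightarrow> Re (ip f f) - 0"
    by (intro tendsto_diff) auto
  then show ?thesis by (simp add: S_def)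
qed

lemma ip_ksec_e: "x \<in> D \<Longrightarrow> k \<ge> 1 \<Longrightarrow> ip (ksec D K x) (e k) = cnj (e k x)"
  using ip_commute[OF ksec_mem e_mem] reproducing[OF e_mem] by simp

text \<open>The coefficients of the kernel section at \<open>x\<close> are the conjugates of
  \<open>e k x\<close>. An upper bound on the tail norm calls for Parseval's equality; Bessel's
  inequality points the other way.\<close>

lemma tail_ksec_le:
  assumes x: "x \<in> D" and t: "\<And>M. (\<Sum>k=Suc r..M. (cmod (e k x))\<^sup>2) \<le> t"
  shows "Re (ip (tail r (ksec D K x)) (tail r (ksec D K x))) \<le> t"
proof -
  let ?f = "ksec D K x"
  let ?S = "\<lambda>n. \<Sum>k=1..n. (cmod (ip ?f (e k)))\<^sup>2"
  have "Re (ip ?f ?f) \<le> ?S r + t"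
  proof (rule LIMSEQ_le_const2[OF Parseval[OF ksec_mem[OF x]]], intro exI allI impI)
    fix n assume "r \<le> n"
    then have "{1..n} = {1..r} \<union> {Suc r..n}" by auto
    then have "?S n = ?S r + (\<Sum>k=Suc r..n. (cmod (ip ?f (e k)))\<^sup>2)"
      by (simp add: sum.union_disjoint)
    also have "(\<Sum>k=Suc r..n. (cmod (ip ?f (e k)))\<^sup>2) = (\<Sum>k=Suc r..n. (cmod (e k x))\<^sup>2)"
      using x by (intro sum.cong) (auto simp: ip_ksec_e)
    finally show "?S n \<le> ?S r + t" using t[of n] by simp
  qed
  then show ?thesis using tail_norm[OF ksec_mem[OF x], of r] by simp
qed

section \<open>Fekete points and the bound on their residuals\<close>

text \<open>A trace argument with \<open>N = length Y\<close>: the values \<open>h y y = 1\<close>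
  sum to \<open>N\<close>. The projections of the kernel sections onto the first \<open>r\<close>
  basis functions contribute at most \<open>r\<close>, their tails at most
  \<open>N * sqrt (t / P)\<close>.\<close>

lemma residual_le_tail:
  assumes Y: "set Y \<subseteq> D" "vol Y \<noteq> 0" and P: "P > 0"
    and resP: "\<And>y. y \<in> set Y \<Longrightarrow> P \<le> Re (res (remove1 y Y) y y)"
    and t: "\<And>x. x \<in> D \<Longrightarrow> Re (ip (tail r (ksec D K x)) (tail r (ksec D K x))) \<le> t"
    and "t \<ge> 0" and r: "r \<le> length Y"
  shows "(real (length Y) - real r)\<^sup>2 * P \<le> (real (length Y))\<^sup>2 * t"
proof -
  define S where "S = set Y"
  define N where "N = length Y"
  have dY: "distinct Y" using vol_distinct Y by blast
  have S: "finite S" "card S = N" "S \<subseteq> D" using dY Y(1) by (auto simp: S_def N_def distinct_card)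
  define Z where "Z y = remove1 y Y" for y
  have Z: "set (Z y) = S - {y}" for y using dY by (simp add: Z_def S_def)
  then have ZD: "set (Z y) \<subseteq> D" for y using S by auto
  define \<rho> where "\<rho> y = Re (res (Z y) y y)" for y
  have \<rho>: "\<rho> y \<ge> P" "\<rho> y > 0" "res (Z y) y y = of_real (\<rho> y)" if "y \<in> S" for y
    using resP[of y] that P res_diag_real[OF ZD, of y y] S(3) by (auto simp: \<rho>_def Z_def S_def)
  \<comment> \<open>Normalised residuals are Lagrange functions for \<open>Y\<close>; the squared
    norm of \<open>h y\<close> is \<open>1 / \<rho> y\<close>, hence at most
    \<open>1 / P\<close>.\<close>
  define h where "h y = (\<lambda>z. of_real (1 / \<rho> y) * res (Z y) y z)" for y
  have rm: "res (Z y) y \<in> H" if "y \<in> S" for y using res_mem[OF ZD] that S by auto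
  have hm: "h y \<in> H" if "y \<in> S" for y unfolding h_def by (rule scale_mem[OF rm[OF that]])
  have hd: "h y z = (if z = y then 1 else 0)" if "y \<in> S" "z \<in> S" for y z
    using that \<rho>[OF that(1)] res_vanish[OF ZD[of y], of y z] Z[of y] S(3) by (auto simp: h_def)
  have hn: "Re (ip (h y) (h y)) \<le> 1 / P" if y: "y \<in> S" for y
  proof -
    have "ip (h y) (h y) = of_real (1 / \<rho> y) * (of_real (1 / \<rho> y) * ip (res (Z y) y) (res (Z y) y))"
      using ip_scale_left[OF rm[OF y] hm[OF y], of "of_real (1 / \<rho> y)"]
        ip_scale_right[OF rm[OF y] rm[OF y], of "of_real (1 / \<rho> y)"]
      by (simp only: h_def complex_cnj_complex_of_real)
    also have "\<dots> = of_real (1 / \<rho> y)"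
      using res_self[OF ZD, of y y] y S(3) \<rho>[OF y] by auto
    finally show ?thesis using \<rho>[OF y] P by (simp add: frac_le)
  qed
  \<comment> \<open>Functions vanishing on all of \<open>Y\<close> are orthogonal to the span of the
    Lagrange functions.\<close>
  have hp: "ip f (h y) = 0" if "f \<in> H" "\<And>z. z \<in> S \<Longrightarrow> f z = 0" "y \<in> S" for f y
  proof -
    have "ip f (res (Z y) y) = f y" using that Z S(3) by (intro ip_res ZD) auto
    then show ?thesis using that ip_scale_right[OF rm[OF that(3)] that(1), of "of_real (1 / \<rho> y)"]
      by (simp add: h_def)
  qed
  \<comment> \<open>\<open>Q k\<close> interpolates \<open>e k\<close> on \<open>Y\<close>. By
    \<open>hp\<close> it is the orthogonal projection of \<open>e k\<close> onto the span of the
    Lagrange functions, so \<open>1 - ip (Q k) (e k)\<close> is a squared norm.\<close>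
  define Q where "Q k = (\<lambda>z. \<Sum>y\<in>S. e k y * h y z)" for k
  have Qm: "Q k \<in> H" for k unfolding Q_def using hm by (rule lincomb_mem)
  have Qe: "Re (ip (Q k) (e k)) \<le> 1" if k: "k \<ge> 1" for k
  proof -
    let ?g = "\<lambda>z. e k z - Q k z"
    have g: "?g \<in> H" using diff_mem e_mem k Qm by blast
    have "Q k z = e k z" if "z \<in> S" for z
    proof -
      have "Q k z = (\<Sum>y\<in>S. if y = z then e k y else 0)"
        unfolding Q_def using that hd by (intro sum.cong) auto
      then show ?thesis using that S(1) by (simp add: sum.delta)
    qed
    then have "ip ?g (h y) = 0" if "y \<in> S" for y using that by (intro hp g) auto
    moreover have "ip ?g (Q k) = (\<Sum>y\<in>S. cnj (e k y) * ip ?g (h y))"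
      unfolding Q_def[of k] using hm g[unfolded Q_def] by (rule ip_lincomb_right)
    ultimately have "ip ?g (Q k) = 0" by simp
    then have "ip ?g ?g = ip ?g (e k)" using ip_diff_right[OF e_mem[OF k] Qm g] by simp
    also have "\<dots> = 1 - ip (Q k) (e k)"
      using ip_diff_left[OF e_mem[OF k] Qm e_mem[OF k]] e_orthonormal[OF k k] by simp
    finally show ?thesis using ip_nonneg[OF g] by simp
  qed
  define T where "T y = tail r (ksec D K y)" for y
  have Tm: "T y \<in> H" if "y \<in> S" for y unfolding T_def using that S tail_mem ksec_mem by blast
  have one: "1 = ip (h y) (T y) + (\<Sum>k=1..r. e k y * ip (h y) (e k))" if y: "y \<in> S" for y
  proof -
    have yD: "y \<in> D" using y S by auto
    have "ip (h y) (T y) = ip (h y) (ksec D K y) - ip (h y) (proj r (ksec D K y))"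
      unfolding T_def tail_def by (rule ip_diff_right[OF ksec_mem[OF yD] proj_mem hm[OF y]])
    moreover have "ip (h y) (ksec D K y) = 1" using reproducing[OF hm[OF y] yD] hd[OF y y] by simp
    moreover have "ip (h y) (proj r (ksec D K y))
        = (\<Sum>k=1..r. cnj (ip (ksec D K y) (e k)) * ip (h y) (e k))"
      unfolding proj_def using hm[OF y] by (intro ip_lincomb_right) (auto simp: e_mem)
    moreover have "\<dots> = (\<Sum>k=1..r. e k y * ip (h y) (e k))"
      using yD by (intro sum.cong) (auto simp: ip_ksec_e)
    ultimately show ?thesis by simp
  qed
  have "of_nat N = (\<Sum>y\<in>S. (1::complex))" using S by simp
  also have "\<dots> = (\<Sum>y\<in>S. ip (h y) (T y) + (\<Sum>k=1..r. e k y * ip (h y) (e k)))"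
    using one by (rule sum.cong[OF refl])
  \<comment> \<open>Exchanging the sums collects the projection parts into a trace over the first
    \<open>r\<close> basis functions, each term of which is at most 1 by \<open>Qe\<close>.\<close>
  also have "\<dots> = (\<Sum>y\<in>S. ip (h y) (T y)) + (\<Sum>k=1..r. \<Sum>y\<in>S. e k y * ip (h y) (e k))"
    by (simp add: sum.distrib sum.swap[of _ S])
  also have "(\<Sum>k=1..r. \<Sum>y\<in>S. e k y * ip (h y) (e k)) = (\<Sum>k=1..r. ip (Q k) (e k))"
    unfolding Q_def using hm by (intro sum.cong refl ip_lincomb_left[symmetric]) (auto simp: e_mem)
  finally have eq: "complex_of_nat N = (\<Sum>y\<in>S. ip (h y) (T y)) + (\<Sum>k=1..r. ip (Q k) (e k))" .
  have "real N = (\<Sum>y\<in>S. Re (ip (h y) (T y))) + (\<Sum>k=1..r. Re (ip (Q k) (e k)))"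
    using arg_cong[OF eq, of Re] by simp
  also have "(\<Sum>k=1..r. Re (ip (Q k) (e k))) \<le> (\<Sum>k=1..r. 1)"
    using Qe by (intro sum_mono) auto
  also have "(\<Sum>y\<in>S. Re (ip (h y) (T y))) \<le> (\<Sum>y\<in>S. sqrt (t / P))"
  proof (rule sum_mono)
    fix y assume y: "y \<in> S"
    have "Re (ip (h y) (h y)) * Re (ip (T y) (T y)) \<le> (1 / P) * t"
      using hn[OF y] t[of y] y S(3) ip_nonneg[OF Tm[OF y]] P
      by (intro mult_mono) (auto simp: T_def)
    then have "(cmod (ip (h y) (T y)))\<^sup>2 \<le> t / P"
      using Cauchy_Schwarz[OF hm[OF y] Tm[OF y]] by simp
    then have "cmod (ip (h y) (T y)) \<le> sqrt (t / P)" by (rule real_le_rsqrt)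
    then show "Re (ip (h y) (T y)) \<le> sqrt (t / P)" using complex_Re_le_cmod order_trans by blast
  qed
  finally have "real N - real r \<le> real N * sqrt (t / P)" using S by simp
  then have "(real N - real r)\<^sup>2 \<le> (real N * sqrt (t / P))\<^sup>2"
    using r by (intro power_mono) (auto simp: N_def)
  also have "\<dots> = (real N)\<^sup>2 * t / P" using P \<open>t \<ge> 0\<close> by (simp add: power_mult_distrib)
  finally show ?thesis using P by (simp add: N_def field_simps)
qed

text \<open>Greedy choice: a point with positive residual keeps the Gram determinant positive. If
  there is none, sampling is already exact, and stays so after padding with \<open>x0\<close> by
  monotonicity.\<close>

lemma nondegenerate_or_exact:
  assumes "x0 \<in> D"
  shows "\<exists>X. length X = n \<and> set X \<subseteq> D \<and> (vol X > 0 \<or> (\<forall>x\<in>D. Re (res X x x) = 0))"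
proof (induction n)
  case (Suc n)
  then obtain X where X: "length X = n" "set X \<subseteq> D" "vol X > 0 \<or> (\<forall>x\<in>D. Re (res X x x) = 0)"
    by blast
  show ?case
  proof (cases "\<forall>x\<in>D. Re (res X x x) = 0")
    case True
    have "Re (res (x0 # X) x x) = 0" if "x \<in> D" for x
      using res_diag_mono[of X "x0 # X" x] res_diag_nonneg[of "x0 # X" x] True that assms X(2)
      by (auto simp del: res.simps)
    then show ?thesis using X assms by (intro exI[of _ "x0 # X"]) (auto simp del: res.simps)
  next
    case False
    then obtain x where x: "x \<in> D" "Re (res X x x) > 0"
      using res_diag_nonneg[OF X(2)] by (auto simp: less_le)
    then have "vol (x # X) > 0" using False X by auto
    then show ?thesis using X x by (intro exI[of _ "x # X"]) auto
  qed
qed (simp add: exI[of _ "[]"])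

text \<open>Nodes within a factor 2 of the supremal Gram determinant suffice, so the existence of a
  maximiser is not at issue. In the bound, 8 is this factor 2 times the 4 lost in
  \<open>N - r \<ge> N / 2\<close> after squaring, where \<open>N = Suc n\<close>.\<close>

lemma fekete_points:
  assumes "x0 \<in> D" and B: "\<And>x. x \<in> D \<Longrightarrow> Re (K x x) \<le> B" "B \<ge> 0"
    and t: "\<And>x M. x \<in> D \<Longrightarrow> (\<Sum>k=Suc r..M. (cmod (e k x))\<^sup>2) \<le> t"
    and n: "2 * r \<le> Suc n"
  shows "\<exists>X. length X = n \<and> set X \<subseteq> D \<and> (\<forall>x\<in>D. Re (res X x x) \<le> 8 * t)"
proof -
  have t0: "t \<ge> 0" using t[OF assms(1), of 0] by simp
  obtain X0 where X0: "length X0 = n" "set X0 \<subseteq> D" "vol X0 > 0 \<or> (\<forall>x\<in>D. Re (res X0 x x) = 0)"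
    using nondegenerate_or_exact[OF assms(1)] by blast
  show ?thesis
  proof (cases "\<forall>x\<in>D. Re (res X0 x x) = 0")
    case True
    then show ?thesis using X0 t0 by auto
  next
    case False
    define A where "A = vol ` {X. length X = n \<and> set X \<subseteq> D}"
    have bdd: "bdd_above A" using vol_bound[OF B] by (auto simp: A_def intro!: bdd_aboveI[of _ "B ^ n"])
    have "vol X0 > 0" using False X0 by blast
    moreover have "vol X0 \<le> Sup A" using X0 by (intro cSup_upper bdd) (auto simp: A_def)
    ultimately have "Sup A / 2 < Sup A" by simp
    moreover have "A \<noteq> {}" using X0 by (auto simp: A_def)
    \<comment> \<open>Positivity of the supremum, supplied by \<open>X0\<close>, makes its half
      strictly smaller and hence exceeded by some node set.\<close>
    ultimately obtain X where X: "length X = n" "set X \<subseteq> D" "Sup A / 2 < vol X"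
      using less_cSup_iff[OF _ bdd, of "Sup A / 2"] unfolding A_def by blast
    have vX: "vol X > 0" using X \<open>vol X0 > 0\<close> \<open>vol X0 \<le> Sup A\<close> by simp
    have "Re (res X x x) \<le> 8 * t" if x: "x \<in> D" for x
    proof (cases "Re (res X x x) = 0")
      case True
      then show ?thesis using t0 by simp
    next
      case False
      define R where "R = Re (res X x x)"
      have R: "R > 0" using False res_diag_nonneg[OF X(2) x] by (simp add: R_def)
      let ?Y = "x # X"
      have Y: "set ?Y \<subseteq> D" "vol ?Y = R * vol X" using X x by (auto simp: R_def)
      \<comment> \<open>\<open>vol ?Y\<close> is expanded in two ways: by deleting \<open>x\<close>
        it is \<open>R * vol X\<close>, by deleting \<open>y\<close> it is a residual times a
        determinant of \<open>n\<close> points, which is at most \<open>2 * vol X\<close>.\<close>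
      have rP: "R / 2 \<le> Re (res (remove1 y ?Y) y y)" if y: "y \<in> set ?Y" for y
      proof -
        let ?Z = "remove1 y ?Y"
        have Z: "length ?Z = n" "set ?Z \<subseteq> D"
          using y X(1) Y(1) set_remove1_subset[of y ?Y] by (simp_all only: length_remove1) auto
        have "vol ?Z \<le> Sup A" using Z by (intro cSup_upper bdd) (auto simp: A_def)
        then have "vol ?Z \<le> 2 * vol X" using X(3) by simp
        moreover have "Re (res ?Z y y) \<ge> 0" using res_diag_nonneg[OF Z(2)] y Y(1) by blast
        ultimately have "Re (res ?Z y y) * vol ?Z \<le> Re (res ?Z y y) * (2 * vol X)"
          by (intro mult_left_mono)
        then have "R * vol X \<le> (2 * Re (res ?Z y y)) * vol X"
          using vol_remove1[OF Y(1) y] Y(2) by (simp add: mult_ac)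
        then show ?thesis using vX by simp
      qed
      have "(real (length ?Y) - real r)\<^sup>2 * (R / 2) \<le> (real (length ?Y))\<^sup>2 * t"
        using Y R vX rP n X(1) t0 by (intro residual_le_tail tail_ksec_le t) auto
      moreover have "(real (length ?Y) / 2)\<^sup>2 \<le> (real (length ?Y) - real r)\<^sup>2"
        using n X(1) by (intro power_mono) auto
      ultimately have "(real (length ?Y) / 2)\<^sup>2 * (R / 2) \<le> (real (length ?Y))\<^sup>2 * t"
        using R by (meson half_gt_zero less_imp_le mult_right_mono order_trans)
      then have "(real (length ?Y))\<^sup>2 * R \<le> (real (length ?Y))\<^sup>2 * (8 * t)"
        by (simp add: power_divide)
      then show ?thesis by (simp add: R_def del: of_nat_Suc)
    qed
    then show ?thesis using X by blast
  qed
qed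

end

section \<open>Basis tails bounded by the averaged Christoffel sums\<close>

text \<open>As \<open>l i / i\<close> decreases, \<open>l k\<close> is at most twice the sum of
  \<open>l i / i\<close> over the window from \<open>k / 2\<close> to \<open>k\<close>. Exchanging
  the sums then gathers the \<open>a k\<close> belonging to each \<open>i\<close>.\<close>

lemma sum_tail_le_averages:
  fixes a l :: "nat \<Rightarrow> real"
  assumes a: "\<And>k. a k \<ge> 0" and l: "\<And>k. k \<ge> 1 \<Longrightarrow> l k \<ge> 0" "\<And>j k. 1 \<le> j \<Longrightarrow> j \<le> k \<Longrightarrow> l k \<le> l j"
    and s: "s \<ge> 1"
  shows "(\<Sum>k=2 * s..M. l k * a k) \<le> 2 * (\<Sum>i=s..M. (\<Sum>k=1..4 * i. a k) * (l i / real i))"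
proof -
  have half: "l k \<le> 2 * (\<Sum>i | i \<in> {s..M} \<and> k \<le> 4 * i. l i / real i)" if k: "k \<in> {2 * s..M}" for k
  proof -
    have k1: "k \<ge> 1" using k s by auto
    \<comment> \<open>The window has \<open>k div 2 + 1\<close> elements, which is at least
      \<open>k / 2\<close> for either parity.\<close>
    have "real (k div 2 + 1) * (l k / real k) = (\<Sum>i\<in>{k - k div 2..k}. l k / real k)"
      by simp
    also have "\<dots> \<le> (\<Sum>i\<in>{k - k div 2..k}. l i / real i)"
      using k1 l by (intro sum_mono frac_le) auto
    \<comment> \<open>The window starts at \<open>s\<close> or later because
      \<open>k \<ge> 2 * s\<close>, and its elements satisfy \<open>k \<le> 2 * i\<close>, hence
      \<open>k \<le> 4 * i\<close>.\<close>
    also have "\<dots> \<le> (\<Sum>i | i \<in> {s..M} \<and> k \<le> 4 * i. l i / real i)"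
      using k s l(1) by (intro sum_mono2) auto
    finally have *: "real (k div 2 + 1) * (l k / real k) \<le> (\<Sum>i | i \<in> {s..M} \<and> k \<le> 4 * i. l i / real i)" .
    have "k \<le> 2 * (k div 2 + 1)" by presburger
    then have "real k \<le> 2 * real (k div 2 + 1)" by (metis of_nat_le_iff of_nat_mult of_nat_numeral)
    then have "real k * (l k / real k) \<le> 2 * real (k div 2 + 1) * (l k / real k)"
      using l(1)[OF k1] by (intro mult_right_mono) auto
    also have "\<dots> \<le> 2 * (\<Sum>i | i \<in> {s..M} \<and> k \<le> 4 * i. l i / real i)"
      using * by (simp only: mult.assoc)
    finally show ?thesis using k1 by simp
  qed
  have "(\<Sum>k=2 * s..M. l k * a k)
      \<le> (\<Sum>k=2 * s..M. 2 * (\<Sum>i | i \<in> {s..M} \<and> k \<le> 4 * i. l i / real i) * a k)"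
    by (intro sum_mono mult_right_mono half a)
  also have "\<dots> = 2 * (\<Sum>k=2 * s..M. \<Sum>i | i \<in> {s..M} \<and> k \<le> 4 * i. a k * (l i / real i))"
    by (simp add: sum_distrib_left sum_distrib_right mult_ac)
  also have "(\<Sum>k=2 * s..M. \<Sum>i | i \<in> {s..M} \<and> k \<le> 4 * i. a k * (l i / real i))
      = (\<Sum>i=s..M. \<Sum>k | k \<in> {2 * s..M} \<and> k \<le> 4 * i. a k * (l i / real i))"
    by (rule sum.swap_restrict) auto
  also have "\<dots> \<le> (\<Sum>i=s..M. \<Sum>k=1..4 * i. a k * (l i / real i))"
    using s a l(1) by (intro sum_mono sum_mono2) auto
  finally show ?thesis by (simp only: sum_distrib_right)
qed

text \<open>With \<open>a k\<close> the squared modulus of the \<open>L_2\<close>-normalised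
  eigenfunction at \<open>x\<close>, the summand is \<open>lam k * a k\<close>, and the sum of the
  first \<open>4 * i\<close> values \<open>a k\<close> is at most
  \<open>Nrho D e lam (4 * i)\<close>.\<close>

lemma sum_basis_tail_le_Nrho:
  assumes x: "x \<in> D" and lam: "\<And>k. k \<ge> 1 \<Longrightarrow> lam k > 0 \<and> lam (Suc k) \<le> lam k" and s: "s \<ge> 1"
  shows "ennreal (\<Sum>k=2 * s..M. (cmod (e k x))\<^sup>2)
    \<le> 2 * (\<Sum>k. if k \<ge> s then Nrho D e lam (4 * k) * ennreal ((sig lam k)\<^sup>2 / real k) else 0)"
proof -
  define a where "a k = (cmod (complex_of_real (1 / sqrt (lam k)) * e k x))\<^sup>2" for k
  have a0: "a k \<ge> 0" for k by (simp add: a_def)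
  have mono: "lam k \<le> lam j" if "1 \<le> j" "j \<le> k" for j k
    using that(2)
  proof (induction rule: dec_induct)
    case (step n)
    then show ?case using lam[of n] that(1) by linarith
  qed simp
  have N: "ennreal (\<Sum>k=1..j. a k) \<le> Nrho D e lam j" for j
    unfolding Nrho_def a_def using x by (rule SUP_upper)
  have "(\<Sum>k=2 * s..M. (cmod (e k x))\<^sup>2) = (\<Sum>k=2 * s..M. lam k * a k)"
  proof (rule sum.cong[OF refl])
    fix k assume "k \<in> {2 * s..M}"
    then have "lam k > 0" using s lam[of k] by auto
    then show "(cmod (e k x))\<^sup>2 = lam k * a k"
      by (simp add: a_def norm_mult norm_divide power_mult_distrib power_divide)
  qed
  also have "\<dots> \<le> 2 * (\<Sum>i=s..M. (\<Sum>k=1..4 * i. a k) * (lam i / real i))"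
    using a0 lam mono s by (intro sum_tail_le_averages) (auto simp: less_imp_le)
  finally have "ennreal (\<Sum>k=2 * s..M. (cmod (e k x))\<^sup>2)
      \<le> ennreal (2 * (\<Sum>i=s..M. (\<Sum>k=1..4 * i. a k) * (lam i / real i)))" by (rule ennreal_leI)
  also have "\<dots> = 2 * (\<Sum>i=s..M. ennreal (\<Sum>k=1..4 * i. a k) * ennreal (lam i / real i))"
  proof -
    have nn: "lam i / real i \<ge> 0" if "i \<in> {s..M}" for i using that s lam[of i] by auto
    have "ennreal (\<Sum>i=s..M. (\<Sum>k=1..4 * i. a k) * (lam i / real i))
        = (\<Sum>i=s..M. ennreal ((\<Sum>k=1..4 * i. a k) * (lam i / real i)))"
      using nn a0 by (intro sum_ennreal[symmetric]) (blast intro: mult_nonneg_nonneg sum_nonneg)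
    also have "\<dots> = (\<Sum>i=s..M. ennreal (\<Sum>k=1..4 * i. a k) * ennreal (lam i / real i))"
      using nn a0 by (intro sum.cong refl ennreal_mult) (auto intro!: sum_nonneg)
    finally show ?thesis by (simp add: ennreal_mult')
  qed
  also have "\<dots> \<le> 2 * (\<Sum>i=s..M. if i \<ge> s then Nrho D e lam (4 * i) * ennreal ((sig lam i)\<^sup>2 / real i) else 0)"
  proof (intro mult_left_mono sum_mono)
    fix i assume i: "i \<in> {s..M}"
    then have "(sig lam i)\<^sup>2 = lam i" using s lam[of i] by (simp add: sig_def)
    then show "ennreal (\<Sum>k=1..4 * i. a k) * ennreal (lam i / real i)
      \<le> (if i \<ge> s then Nrho D e lam (4 * i) * ennreal ((sig lam i)\<^sup>2 / real i) else 0)"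
      using i N[of "4 * i"] by (auto intro!: mult_right_mono)
  qed simp
  also have "\<dots> \<le> 2 * (\<Sum>k. if k \<ge> s then Nrho D e lam (4 * k) * ennreal ((sig lam k)\<^sup>2 / real k) else 0)"
    by (intro mult_left_mono sum_le_suminf) auto
  finally show ?thesis .
qed

section \<open>Assembly of the estimate and its constants\<close>

lemma sampling_number_bound:
  assumes set: "setting d D M K H ip e lam" and m: "m \<ge> 1"
  defines "S \<equiv> (\<Sum>k. if k \<ge> max 1 (m div 4)
    then Nrho D e lam (4 * k) * ennreal ((sig lam k)\<^sup>2 / real k) else 0)"
  shows "(sampling_number D H ip (4 * m))\<^sup>2 \<le> 64 * S"
proof (cases "S = \<infinity>")
  case True
  then show ?thesis by (simp add: ennreal_mult_top)
next
  case False
  note st = set[unfolded setting_def]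
  interpret rkhs_onb D K H ip e
    by unfold_locales (use st in blast)+
  have lam: "lam k > 0 \<and> lam (Suc k) \<le> lam k" if "k \<ge> 1" for k using st that by blast
  have "prob_space M" "space M = D" using st by blast+
  then obtain x0 where x0: "x0 \<in> D" using prob_space.not_empty by blast
  obtain B where "\<forall>x\<in>D. cmod (K x x) \<le> B" using st by blast
  then have B: "Re (K x x) \<le> \<bar>B\<bar>" if "x \<in> D" for x
    using that complex_Re_le_cmod[of "K x x"] by fastforce
  define s where "s = max 1 (m div 4)"
  define t where "t = 2 * enn2real S"
  have S: "2 * S = ennreal t" using False by (simp add: t_def ennreal_mult' less_top)
  have t0: "t \<ge> 0" by (simp add: t_def)
  have s: "s \<ge> 1" "s \<le> m" using m by (auto simp: s_def)
  have "(\<Sum>k=Suc (2 * s - 1)..M. (cmod (e k x))\<^sup>2) \<le> t" if "x \<in> D" for x M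
  proof -
    have "ennreal (\<Sum>k=2 * s..M. (cmod (e k x))\<^sup>2) \<le> 2 * S"
      unfolding S_def s_def[symmetric] using that lam s(1) by (rule sum_basis_tail_le_Nrho)
    then show ?thesis using S t0 s by simp
  qed
  \<comment> \<open>The tail starts at \<open>2 * s\<close>, so the projection has rank
    \<open>r = 2 * s - 1\<close>; since \<open>s \<le> m\<close>, \<open>4 * m\<close> nodes meet
    the condition of \<open>fekete_points\<close>.\<close>
  moreover have "2 * (2 * s - 1) \<le> Suc (4 * m)" using s by linarith
  ultimately obtain X where X: "length X = 4 * m" "set X \<subseteq> D" "\<And>x. x \<in> D \<Longrightarrow> Re (res X x x) \<le> 8 * t"
    using fekete_points[OF x0 B abs_ge_zero, of "2 * s - 1" t "4 * m"] by blast
  have "sampling_number D H ip (4 * m) \<le> ennreal (2 * sqrt (8 * t))"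
    using sampling_number_le[OF B X(2,3)] X(1) by simp
  then have "(sampling_number D H ip (4 * m))\<^sup>2 \<le> (ennreal (2 * sqrt (8 * t)))\<^sup>2"
    by (rule power_mono) simp
  \<comment> \<open>The squared error factor 4 times the 8 from the Fekete points gives 32;
    \<open>t = 2 * S\<close> doubles it to 64.\<close>
  also have "\<dots> = ennreal (32 * t)"
    using t0 by (simp add: ennreal_power power_mult_distrib)
  also have "\<dots> = 32 * (2 * S)" using t0 S by (simp add: ennreal_mult')
  finally show ?thesis by (simp add: mult.assoc[symmetric])
qed

theorem theorem2p1:
  shows "\<exists>c1 c2 :: nat. c1 \<ge> 1 \<and> c2 \<ge> 1 \<and>
    (\<forall>d D M K H ip e lam (m :: nat).
       setting d D M K H ip e lam \<and> m \<ge> 1 \<longrightarrow>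
       (sampling_number D H ip (c1 * m))\<^sup>2
         \<le> of_nat c2 *
           max (Nrho D e lam m / of_nat m *
                  (\<Sum>k. if k \<ge> max 1 (m div 2) then ennreal ((sig lam k)\<^sup>2) else 0))
               (\<Sum>k. if k \<ge> max 1 (m div 4)
                       then Nrho D e lam (4 * k) * ennreal ((sig lam k)\<^sup>2 / real k) else 0))"
proof (rule exI[of _ 4], rule exI[of _ 64], intro conjI allI impI)
  fix d D M K H ip e lam and m :: nat
  assume "setting d D M K H ip e lam \<and> m \<ge> 1"
  then have "(sampling_number D H ip (4 * m))\<^sup>2 \<le> 64 * (\<Sum>k. if k \<ge> max 1 (m div 4)
                       then Nrho D e lam (4 * k) * ennreal ((sig lam k)\<^sup>2 / real k) else 0)"
    using sampling_number_bound by blast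
  also have "\<dots> \<le> of_nat 64 *
           max (Nrho D e lam m / of_nat m *
                  (\<Sum>k. if k \<ge> max 1 (m div 2) then ennreal ((sig lam k)\<^sup>2) else 0))
               (\<Sum>k. if k \<ge> max 1 (m div 4)
                       then Nrho D e lam (4 * k) * ennreal ((sig lam k)\<^sup>2 / real k) else 0)"
    by (simp only: of_nat_numeral, intro mult_left_mono max.cobounded2) simp
  finally show "(sampling_number D H ip (4 * m))\<^sup>2 \<le> of_nat 64 *
           max (Nrho D e lam m / of_nat m *
                  (\<Sum>k. if k \<ge> max 1 (m div 2) then ennreal ((sig lam k)\<^sup>2) else 0))
               (\<Sum>k. if k \<ge> max 1 (m div 4)
                       then Nrho D e lam (4 * k) * ennreal ((sig lam k)\<^sup>2 / real k) else 0)" .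
qed auto

end
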